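(* Let $X$ be a Fréchet space, let $\mathcal{P}$ be an $X$-relation such that $\mathrm{Close}(\mathcal{P},\lambda)$ is input-resilient for all $\lambda\in\mathbb{C}$, and let $L\in\mathbb{C}^{n\times n}$ be a matrix having $\mathbf{1}_n:=(1,\dots,1)$ as an eigenvector, associated to some eigenvalue $\lambda_1$. Then $\mathrm{Close}(\mathcal{P}^{\oplus n},L)$ synchronizes in $X^n$ if and only if $\mathrm{Close}(\mathcal{P},\lambda)$ is stable for every $\lambda\in\mathrm{Spec}(L)$ excluding one instance of $\lambda_1$ (i.e. for every $\lambda$ in the multiset of eigenvalues of $L$, counted with algebraic multiplicity, from which one copy of $\lambda_1$ has been removed).
   Context: All vector spaces are over $\mathbb{C}$. A time set $\mathbb{T}$ is either $\mathbb{R}_{\ge0}$ (continuous time) or $\mathbb{Z}_{\ge0}$ (discrete time). For a Fréchet space $X$, $C^\infty_{\mathrm{loc}}(\mathbb{R}_{\ge0},X)$ is the space of smooth functions $\mathbb{R}_{\ge 0}\to X$ with the topology of uniform convergence of all derivatives on compact sets; $C^\infty_{\mathrm{loc}}(\mathbb{Z}_{\ge0},X)$ is the space of all sequences in $X$ with the topology of pointwise convergence. Relations: for Fréchet spaces $U,Y$, a $(U,Y)$-relation is a linear subspace $\mathcal{P}\subseteq C^\infty_{\mathrm{loc}}(\mathbb{T},U)\times C^\infty_{\mathrm{loc}}(\mathbb{T},Y)$ invariant under translation in time (if $(u,y)\in\mathcal{P}$ and $s\in\mathbb{T}$ then $(u(\cdot+s),y(\cdot+s))\in\mathcal{P}$).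 An $X$-relation is an $(X,X)$-relation. $\mathcal{P}$ is well-defined if for every $u\in C^\infty_{\mathrm{loc}}(\mathbb{T},U)$ there is $y\in C^\infty_{\mathrm{loc}}(\mathbb{T},Y)$ with $(u,y)\in\mathcal{P}$. Stability: $f\in C^\infty_{\mathrm{loc}}(\mathbb{T},X)$ is vanishing if $\lim_{t\to\infty}f(t)=0$ in $X$; for $\mathbb{T}=\mathbb{R}_{\ge0}$ it is smoothly vanishing if $\lim_{t\to\infty}\partial_t^kf(t)=0$ for every $k\ge0$; for $\mathbb{T}=\mathbb{Z}_{\ge0}$ "smoothly vanishing" is read as "vanishing". $\mathcal{P}$ is stable if $y$ is vanishing whenever $(0,y)\in\mathcal{P}$. $\mathcal{P}$ is smoothly VIVO if for every $(u,y)\in\mathcal{P}$ with $u$ smoothly vanishing, $y$ is smoothly vanishing. $\mathcal{P}$ is input-resilient if it is well-defined and (stable implies smoothly VIVO). Interconnection: for a $(U,Y)$-relation $\mathcal{P}$ and a $(Y,U)$-relation $\mathcal{Q}$, $\mathrm{Close}(\mathcal{P},\mathcal{Q})=\{(u,y)\mid (u+z,y)\in\mathcal{P}\text{ and }(y,z)\in\mathcal{Q}\text{ for some }z\in C^\infty_{\mathrm{loc}}(\mathbb{T},U)\}$. $\mathcal{P}^{\oplus n}$ is the $X^n$-relation of all $((u_1,\dots,u_n),(y_1,\dots,y_n))$ with $(u_i,y_i)\in\mathcal{P}$ for each $i$. A scalar $\lambda\in\mathbb{C}$ is identified with the $X$-relation $\{(u,y)\mid y(t)=\lambda u(t)\}$,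 and a matrix $L\in\mathbb{C}^{n\times n}$ with the $X^n$-relation $\{(u,y)\mid y(t)=Lu(t)\}$ ($L$ acting on $X^n$ by $\mathbb{C}$-linear combinations of components). Synchronization: an $X^n$-relation $\mathcal{R}$ synchronizes if every $y\in C^\infty_{\mathrm{loc}}(\mathbb{T},X^n)$ with $(0,y)\in\mathcal{R}$ converges to the diagonal $\Delta_X=\{(x,\dots,x)\mid x\in X\}$, meaning that for every neighbourhood $V$ of zero in $X^n$, $y(t)\in\Delta_X+V$ for all sufficiently large $t$. *)

theory Defs
  imports "HOL-Analysis.Analysis" "HOL-Computational_Algebra.Polynomial"
begin

section \<open>Frechet spaces\<close>

class complex_space = ab_group_add +
  fixes scaleC :: "complex \<Rightarrow> 'a \<Rightarrow> 'a"  (infixr \<open>*\<^sub>C\<close> 75)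
  assumes scaleC_add_right: "a *\<^sub>C (x + y) = a *\<^sub>C x + a *\<^sub>C y"
    and scaleC_add_left: "(a + b) *\<^sub>C x = a *\<^sub>C x + b *\<^sub>C x"
    and scaleC_scaleC: "a *\<^sub>C (b *\<^sub>C x) = (a * b) *\<^sub>C x"
    and scaleC_one: "1 *\<^sub>C x = x"
begin

definition seminorm :: "('a \<Rightarrow> real) \<Rightarrow> bool" where
  "seminorm p \<longleftrightarrow> (\<forall>x y. p (x + y) \<le> p x + p y) \<and> (\<forall>c x. p (c *\<^sub>C x) = cmod c * p x)"

end

text \<open>
  A Frechet space is Hausdorff, its topology is generated by countably many seminorms, and it is
  complete. Sequential completeness suffices, since the topology is metrizable.
\<close>

class frechet_space = complex_space + t2_space +
  assumes frechet: "\<exists>p :: nat \<Rightarrow> 'a \<Rightarrow> real.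
    (\<forall>k. seminorm (p k)) \<and>
    (\<forall>S. open S \<longleftrightarrow> (\<forall>x\<in>S. \<exists>m. \<exists>e>0. \<forall>y. (\<forall>k\<le>m. p k (y - x) < e) \<longrightarrow> y \<in> S)) \<and>
    (\<forall>X :: nat \<Rightarrow> 'a.
      (\<forall>k. \<forall>e>0. \<exists>N. \<forall>i\<ge>N. \<forall>j\<ge>N. p k (X i - X j) < e) \<longrightarrow>
      (\<exists>l. filterlim X (nhds l) sequentially))"

lemma scaleC_zero_left: "0 *\<^sub>C x = (0 :: 'a :: complex_space)"
  using scaleC_add_left[of 0 0 x] by simp

lemma scaleC_minus_one: "(- 1) *\<^sub>C x = - (x :: 'a :: complex_space)"
  using scaleC_add_left[of "- 1" 1 x]
  by (simp add: scaleC_zero_left scaleC_one eq_neg_iff_add_eq_0)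

lemma seminorm_nonneg:
  assumes "seminorm p"
  shows "p (x :: 'a :: complex_space) \<ge> 0"
proof -
  have "p (0 *\<^sub>C x) = cmod 0 * p x" "p ((- 1) *\<^sub>C x) = cmod (- 1) * p x"
    using assms unfolding seminorm_def by blast+
  hence "p 0 = 0" "p (- x) = p x"
    by (simp_all add: scaleC_zero_left scaleC_minus_one)
  moreover have "p (x + (- x)) \<le> p x + p (- x)"
    using assms unfolding seminorm_def by blast
  ultimately show ?thesis by simp
qed

text \<open>
  The product \<open>X\<^sup>n\<close> is the type \<open>'x ^ 'n\<close>, with the product topology of the library.
\<close>

instantiation vec :: (complex_space, finite) complex_space
begin

definition "c *\<^sub>C x = (\<chi> i. c *\<^sub>C x $ i)"

instance
  by standard (simp_all add: vec_eq_iff scaleC_vec_def scaleC_add_right scaleC_add_left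
      scaleC_scaleC scaleC_one)

end

text \<open>
  \<open>HOL-Analysis\<close> has the separation axioms for \<open>'x ^ 'n\<close> only over metric spaces.
\<close>

instance vec :: (t0_space, finite) t0_space
proof
  fix x y :: "'a ^ 'b" assume "x \<noteq> y"
  then obtain i where "x $ i \<noteq> y $ i" by (auto simp: vec_eq_iff)
  then obtain U where U: "open U" "\<not> (x $ i \<in> U \<longleftrightarrow> y $ i \<in> U)"
    by (auto simp: separation_t0)
  show "\<exists>U. open U \<and> \<not> (x \<in> U \<longleftrightarrow> y \<in> U)"
    using U open_vimage_vec_nth[of U i] by (intro exI[of _ "(\<lambda>x. x $ i) -` U"]) auto
qed

instance vec :: (t1_space, finite) t1_space
proof
  fix x y :: "'a ^ 'b" assume "x \<noteq> y"
  then obtain i where "x $ i \<noteq> y $ i" by (auto simp: vec_eq_iff)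
  then obtain U where U: "open U" "x $ i \<in> U" "y $ i \<notin> U" using t1_space by blast
  show "\<exists>U. open U \<and> x \<in> U \<and> y \<notin> U"
    using U open_vimage_vec_nth[of U i] by (intro exI[of _ "(\<lambda>x. x $ i) -` U"]) auto
qed

instance vec :: (t2_space, finite) t2_space
proof
  fix x y :: "'a ^ 'b" assume "x \<noteq> y"
  then obtain i where "x $ i \<noteq> y $ i" by (auto simp: vec_eq_iff)
  then obtain U V where UV: "open U" "open V" "x $ i \<in> U" "y $ i \<in> V" "U \<inter> V = {}"
    using hausdorff by metis
  show "\<exists>U V. open U \<and> open V \<and> x \<in> U \<and> y \<in> V \<and> U \<inter> V = {}"
    using UV open_vimage_vec_nth[of _ i]
    by (intro exI[of _ "(\<lambda>x. x $ i) -` U"] exI[of _ "(\<lambda>x. x $ i) -` V"]) auto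
qed

instance vec :: (frechet_space, finite) frechet_space
proof
  obtain p :: "nat \<Rightarrow> 'a \<Rightarrow> real" where
    p: "\<And>k. seminorm (p k)" and
    op: "\<And>S. open S \<longleftrightarrow> (\<forall>x\<in>S. \<exists>m. \<exists>e>0. \<forall>y. (\<forall>k\<le>m. p k (y - x) < e) \<longrightarrow> y \<in> S)" and
    compl: "\<And>X :: nat \<Rightarrow> 'a.
      (\<forall>k. \<forall>e>0. \<exists>N. \<forall>i\<ge>N. \<forall>j\<ge>N. p k (X i - X j) < e) \<Longrightarrow> (\<exists>l. X \<longlonglongrightarrow> l)"
    using frechet by blast
  define q where "q = (\<lambda>k (v :: 'a ^ 'b). \<Sum>i\<in>UNIV. p k (v $ i))"
  have p_nonneg: "p k z \<ge> 0" for k z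
    by (rule seminorm_nonneg[OF p])
  have p_tri: "p k (x + y) \<le> p k x + p k y" and p_scale: "p k (c *\<^sub>C x) = cmod c * p k x"
    for k x y c using p[of k] unfolding seminorm_def by blast+
  have p_le_q: "p k (v $ i) \<le> q k v" for k v i
    unfolding q_def by (rule member_le_sum) (auto simp: p_nonneg)
  have ball_open: "open {z. \<forall>k\<le>m. p k (z - a) < e}" for m :: nat and a :: 'a and e :: real
    unfolding op
  proof safe
    fix z assume z: "\<forall>k\<le>m. p k (z - a) < e"
    define d where "d = Min ((\<lambda>k. e - p k (z - a)) ` {..m})"
    have "d > 0"
      unfolding d_def using z by (subst Min_gr_iff) auto
    moreover have "p k (y - a) < e" if "\<forall>k\<le>m. p k (y - z) < d" "k \<le> m" for y k
    proof -
      have "d \<le> e - p k (z - a)"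
        unfolding d_def using that by (intro Min_le) auto
      moreover have "p k (y - a) \<le> p k (y - z) + p k (z - a)"
        using p_tri[of k "y - z" "z - a"] by simp
      ultimately show ?thesis using that by fastforce
    qed
    ultimately show "\<exists>n. \<exists>d>0. \<forall>y. (\<forall>k\<le>n. p k (y - z) < d) \<longrightarrow> y \<in> {z. \<forall>k\<le>m. p k (z - a) < e}"
      by blast
  qed
  have "q k (x + y) \<le> q k x + q k y" for k x y
    unfolding q_def sum.distrib[symmetric] by (rule sum_mono) (simp add: p_tri)
  moreover have "q k (c *\<^sub>C x) = cmod c * q k x" for k c x
    unfolding q_def sum_distrib_left by (simp add: scaleC_vec_def p_scale)
  ultimately have semi_q: "seminorm (q k)" for k
    unfolding seminorm_def by blast
  have op_q: "open S \<longleftrightarrow> (\<forall>x\<in>S. \<exists>m. \<exists>e>0. \<forall>y. (\<forall>k\<le>m. q k (y - x) < e) \<longrightarrow> y \<in> S)"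
    (is "_ \<longleftrightarrow> ?R") for S
  proof
    assume S: "open S"
    show ?R
    proof
      fix x assume "x \<in> S"
      then obtain A where A: "\<And>i. open (A i)" "\<And>i. x $ i \<in> A i"
        and AS: "\<And>y. (\<forall>i. y $ i \<in> A i) \<Longrightarrow> y \<in> S"
        using S unfolding open_vec_def by metis
      have "\<forall>i. \<exists>m. \<exists>e>0. \<forall>y. (\<forall>k\<le>m. p k (y - x $ i) < e) \<longrightarrow> y \<in> A i"
        using A op by blast
      then obtain m e where me: "\<And>i. e i > 0"
        "\<And>i y. (\<forall>k\<le>m i. p k (y - x $ i) < e i) \<Longrightarrow> y \<in> A i"
        by metis
      have "Min (range e) > 0"
        using me by (subst Min_gr_iff) auto
      moreover have "y \<in> S" if y: "\<forall>k\<le>Max (range m). q k (y - x) < Min (range e)" for y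
      proof (rule AS, rule allI, rule me(2), safe)
        fix i k assume "k \<le> m i"
        also have "m i \<le> Max (range m)" by (rule Max_ge) auto
        finally have "q k (y - x) < Min (range e)" using y by blast
        moreover have "Min (range e) \<le> e i" by (rule Min_le) auto
        moreover have "p k (y $ i - x $ i) \<le> q k (y - x)"
          using p_le_q[of k "y - x" i] by simp
        ultimately show "p k (y $ i - x $ i) < e i" by linarith
      qed
      ultimately show "\<exists>m. \<exists>e>0. \<forall>y. (\<forall>k\<le>m. q k (y - x) < e) \<longrightarrow> y \<in> S" by blast
    qed
  next
    assume R: ?R
    show "open S"
      unfolding open_vec_def
    proof
      fix x assume "x \<in> S"
      then obtain m e where e: "e > 0" and S: "\<And>y. (\<forall>k\<le>m. q k (y - x) < e) \<Longrightarrow> y \<in> S"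
        using R by blast
      define d where "d = e / real CARD('b)"
      have d: "d > 0" using e unfolding d_def by simp
      define A where "A = (\<lambda>i. {z. \<forall>k\<le>m. p k (z - x $ i) < d})"
      have "p k 0 = 0" for k using p_scale[of k 0 0] by (simp add: scaleC_zero_left)
      hence "open (A i) \<and> x $ i \<in> A i" for i
        using ball_open d unfolding A_def by simp
      moreover have "y \<in> S" if y: "\<forall>i. y $ i \<in> A i" for y
      proof (rule S, safe)
        fix k assume "k \<le> m"
        hence "q k (y - x) < (\<Sum>i\<in>(UNIV :: 'b set). d)"
          using y unfolding q_def A_def by (intro sum_strict_mono) auto
        thus "q k (y - x) < e" by (simp add: d_def)
      qed
      ultimately show "\<exists>A. (\<forall>i. open (A i) \<and> x $ i \<in> A i) \<and> (\<forall>y. (\<forall>i. y $ i \<in> A i) \<longrightarrow> y \<in> S)"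
        by blast
    qed
  qed
  have compl_q: "\<exists>l. X \<longlonglongrightarrow> l"
    if X: "\<forall>k. \<forall>e>0. \<exists>N. \<forall>i\<ge>N. \<forall>j\<ge>N. q k (X i - X j) < e" for X :: "nat \<Rightarrow> 'a ^ 'b"
  proof -
    have "\<exists>l. (\<lambda>n. X n $ c) \<longlonglongrightarrow> l" for c
    proof (rule compl, safe)
      fix k and e :: real assume "e > 0"
      then obtain N where N: "\<forall>i\<ge>N. \<forall>j\<ge>N. q k (X i - X j) < e" using X by blast
      have "p k (X i $ c - X j $ c) < e" if "i \<ge> N" "j \<ge> N" for i j
        using N that p_le_q[of k "X i - X j" c] by fastforce
      thus "\<exists>N. \<forall>i\<ge>N. \<forall>j\<ge>N. p k (X i $ c - X j $ c) < e" by blast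
    qed
    then obtain l where "\<And>c. (\<lambda>n. X n $ c) \<longlonglongrightarrow> l c" by metis
    hence "X \<longlonglongrightarrow> (\<chi> c. l c)" by (intro vec_tendstoI) simp
    thus ?thesis by blast
  qed
  show "\<exists>p :: nat \<Rightarrow> 'a ^ 'b \<Rightarrow> real.
    (\<forall>k. seminorm (p k)) \<and>
    (\<forall>S. open S \<longleftrightarrow> (\<forall>x\<in>S. \<exists>m. \<exists>e>0. \<forall>y. (\<forall>k\<le>m. p k (y - x) < e) \<longrightarrow> y \<in> S)) \<and>
    (\<forall>X :: nat \<Rightarrow> 'a ^ 'b.
      (\<forall>k. \<forall>e>0. \<exists>N. \<forall>i\<ge>N. \<forall>j\<ge>N. p k (X i - X j) < e) \<longrightarrow> (\<exists>l. X \<longlonglongrightarrow> l))"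
    by (intro exI[of _ q] conjI allI impI) (fact semi_q op_q compl_q)+
qed


section \<open>Signals\<close>

text \<open>
  Both time sets are taken as subsets of the real line. A function on \<open>T\<close> is encoded by its
  extension by \<open>0\<close> to the whole real line, so that sums, scalar multiples and the zero signal
  are the pointwise ones.
\<close>

definition time_set :: "real set \<Rightarrow> bool" where
  "time_set T \<longleftrightarrow> T = {0..} \<or> T = \<nat>"

definition diff_quotient :: "(real \<Rightarrow> 'x) \<Rightarrow> real \<Rightarrow> real \<Rightarrow> 'x :: complex_space" where
  "diff_quotient f t = (\<lambda>s. complex_of_real (1 / (s - t)) *\<^sub>C (f s - f t))"

text \<open>The derivative on \<open>{0..}\<close>; at \<open>0\<close> it is one-sided.\<close>

definition time_differentiable :: "(real \<Rightarrow> 'x :: frechet_space) \<Rightarrow> bool" where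
  "time_differentiable f \<longleftrightarrow>
    (\<forall>t\<ge>0. \<exists>l. (diff_quotient f t \<longlongrightarrow> l) (at t within {0..}))"

definition time_deriv :: "(real \<Rightarrow> 'x) \<Rightarrow> real \<Rightarrow> 'x :: frechet_space" where
  "time_deriv f = (\<lambda>t. if t \<ge> 0 then Lim (at t within {0..}) (diff_quotient f t) else 0)"

definition time_smooth :: "(real \<Rightarrow> 'x :: frechet_space) \<Rightarrow> bool" where
  "time_smooth f \<longleftrightarrow> (\<forall>k. time_differentiable ((time_deriv ^^ k) f))"

definition signals :: "real set \<Rightarrow> (real \<Rightarrow> 'x :: frechet_space) set" where
  "signals T = {f. (\<forall>t. t \<notin> T \<longrightarrow> f t = 0) \<and> (T = {0..} \<longrightarrow> time_smooth f)}"

definition shift :: "real set \<Rightarrow> real \<Rightarrow> (real \<Rightarrow> 'x) \<Rightarrow> real \<Rightarrow> 'x :: zero" where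
  "shift T s f = (\<lambda>t. if t \<in> T then f (t + s) else 0)"

definition time_to_infinity :: "real set \<Rightarrow> real filter" where
  "time_to_infinity T = inf at_top (principal T)"

definition vanishing :: "real set \<Rightarrow> (real \<Rightarrow> 'x :: frechet_space) \<Rightarrow> bool" where
  "vanishing T f \<longleftrightarrow> (f \<longlongrightarrow> 0) (time_to_infinity T)"

definition smoothly_vanishing :: "real set \<Rightarrow> (real \<Rightarrow> 'x :: frechet_space) \<Rightarrow> bool" where
  "smoothly_vanishing T f \<longleftrightarrow>
    (if T = {0..} then \<forall>k. vanishing T ((time_deriv ^^ k) f) else vanishing T f)"


section \<open>Relations\<close>

type_synonym ('u, 'y) rel = "((real \<Rightarrow> 'u) \<times> (real \<Rightarrow> 'y)) set"

definition relation :: "real set \<Rightarrow> ('u :: frechet_space, 'y :: frechet_space) rel \<Rightarrow> bool" where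
  "relation T P \<longleftrightarrow>
    P \<subseteq> signals T \<times> signals T \<and>
    (\<lambda>_. 0, \<lambda>_. 0) \<in> P \<and>
    (\<forall>u y u' y'. (u, y) \<in> P \<longrightarrow> (u', y') \<in> P \<longrightarrow> (\<lambda>t. u t + u' t, \<lambda>t. y t + y' t) \<in> P) \<and>
    (\<forall>c u y. (u, y) \<in> P \<longrightarrow> (\<lambda>t. c *\<^sub>C u t, \<lambda>t. c *\<^sub>C y t) \<in> P) \<and>
    (\<forall>u y. \<forall>s\<in>T. (u, y) \<in> P \<longrightarrow> (shift T s u, shift T s y) \<in> P)"

definition well_defined :: "real set \<Rightarrow> ('u :: frechet_space, 'y :: frechet_space) rel \<Rightarrow> bool" where
  "well_defined T P \<longleftrightarrow> (\<forall>u\<in>signals T. \<exists>y\<in>signals T. (u, y) \<in> P)"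

definition stable_rel :: "real set \<Rightarrow> ('u :: frechet_space, 'y :: frechet_space) rel \<Rightarrow> bool" where
  "stable_rel T P \<longleftrightarrow> (\<forall>y. (\<lambda>_. 0, y) \<in> P \<longrightarrow> vanishing T y)"

definition smoothly_VIVO :: "real set \<Rightarrow> ('u :: frechet_space, 'y :: frechet_space) rel \<Rightarrow> bool" where
  "smoothly_VIVO T P \<longleftrightarrow>
    (\<forall>u y. (u, y) \<in> P \<longrightarrow> smoothly_vanishing T u \<longrightarrow> smoothly_vanishing T y)"

definition input_resilient :: "real set \<Rightarrow> ('u :: frechet_space, 'y :: frechet_space) rel \<Rightarrow> bool" where
  "input_resilient T P \<longleftrightarrow> well_defined T P \<and> (stable_rel T P \<longrightarrow> smoothly_VIVO T P)"

definition Close :: "real set \<Rightarrow> ('u :: frechet_space, 'y :: frechet_space) rel \<Rightarrow> ('y, 'u) rel \<Rightarrow> ('u, 'y) rel"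
  where "Close T P Q = {(u, y). u \<in> signals T \<and> y \<in> signals T \<and>
    (\<exists>z\<in>signals T. (\<lambda>t. u t + z t, y) \<in> P \<and> (y, z) \<in> Q)}"

definition power_rel :: "('x, 'x) rel \<Rightarrow> ('x ^ 'n, 'x ^ 'n) rel" where
  "power_rel P = {(u, y). \<forall>i. (\<lambda>t. u t $ i, \<lambda>t. y t $ i) \<in> P}"

definition scalar_rel :: "real set \<Rightarrow> complex \<Rightarrow> ('x :: frechet_space, 'x) rel" where
  "scalar_rel T c = {(u, y). u \<in> signals T \<and> y \<in> signals T \<and> (\<forall>t\<in>T. y t = c *\<^sub>C u t)}"

definition matrix_rel :: "real set \<Rightarrow> complex ^ 'n ^ 'n \<Rightarrow> ('x :: frechet_space ^ 'n, 'x ^ 'n) rel" where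
  "matrix_rel T L = {(u, y). u \<in> signals T \<and> y \<in> signals T \<and>
    (\<forall>t\<in>T. y t = (\<chi> i. \<Sum>j\<in>UNIV. L $ i $ j *\<^sub>C u t $ j))}"

text \<open>
  The range of \<^const>\<open>vec\<close> is the diagonal of \<open>X\<^sup>n\<close>.
\<close>

definition synchronizes :: "real set \<Rightarrow> ('x :: frechet_space ^ 'n, 'x ^ 'n) rel \<Rightarrow> bool" where
  "synchronizes T R \<longleftrightarrow>
    (\<forall>y\<in>signals T. (\<lambda>_. 0, y) \<in> R \<longrightarrow>
      (\<forall>V. 0 \<in> interior V \<longrightarrow>
        (\<forall>\<^sub>F t in time_to_infinity T. y t \<in> {d + v | d v. d \<in> range vec \<and> v \<in> V})))"


section \<open>Spectrum of a matrix\<close>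

definition has_eigenvector :: "complex ^ 'n ^ 'n \<Rightarrow> complex ^ 'n \<Rightarrow> complex \<Rightarrow> bool" where
  "has_eigenvector L v c \<longleftrightarrow> v \<noteq> 0 \<and> L *v v = c *s v"

definition charpoly :: "complex ^ 'n ^ 'n \<Rightarrow> complex poly" where
  "charpoly L = det (mat [:0, 1:] - (\<chi> i j. [:L $ i $ j:]))"

text \<open>The multiset of eigenvalues, counted with algebraic multiplicity.\<close>

definition spec_mset :: "complex ^ 'n ^ 'n \<Rightarrow> complex multiset" where
  "spec_mset L = proots (charpoly L)"

end

theory Submission
  imports Defs "HOL-Computational_Algebra.Fundamental_Theorem_Algebra"
begin

text \<open>
  Removing one instance of \<open>\<lambda>\<^sub>1\<close> from the spectrum of \<open>L\<close> amounts to passing to the quotient of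
  \<open>\<complex>\<^sup>n\<close> by the diagonal: the remaining eigenvalues are those of the endomorphism induced there. If
  \<open>c\<close> is one of them, with eigenvector represented by \<open>w\<close>, then \<open>L w = c w + a 1\<close> for some \<open>a\<close>.
  A signal \<open>z\<close> in the kernel of \<open>Close(P, c)\<close> then yields the solution \<open>w z + 1 y\<^sub>0\<close> of the network,
  where \<open>y\<^sub>0\<close> is an output of \<open>Close(P, \<lambda>\<^sub>1)\<close> for the input \<open>a z\<close>; synchronization forces
  \<open>z \<rightarrow> 0\<close>. Conversely, let \<open>y\<close> solve the network and let \<open>v\<close> be a row vector with \<open>v 1 = 0\<close>. Some
  nonzero polynomial in \<open>L\<close> kills \<open>v\<close>. Its linear factors \<open>L - c\<close> are peeled off one at a time: if
  \<open>c\<close> is a quotient eigenvalue, then \<open>v y\<close> is an output of \<open>Close(P, c)\<close> for the input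
  \<open>v (L - c) y\<close>, and smooth vanishing passes from input to output; otherwise \<open>L - c\<close> is injective on
  these row vectors and the factor is superfluous.
\<close>

section \<open>The topology of a Frechet space\<close>

interpretation scaleC: vector_space "scaleC :: complex \<Rightarrow> 'a \<Rightarrow> 'a :: complex_space"
  by unfold_locales (simp_all add: scaleC_add_right scaleC_add_left scaleC_scaleC scaleC_one)

text \<open>Balls of a single seminorm are open, and a basic neighbourhood constrains only finitely
  many seminorms. Limits thus reduce to real limits, which is how continuity of the vector
  operations is obtained below.\<close>

lemma frechet_tendsto_seminorms:
  obtains p :: "nat \<Rightarrow> 'x :: frechet_space \<Rightarrow> real"
  where "\<And>k. seminorm (p k)"
    and "\<And>(f :: 'b \<Rightarrow> 'x) l F. (f \<longlongrightarrow> l) F \<longleftrightarrow> (\<forall>k. ((\<lambda>t. p k (f t - l)) \<longlongrightarrow> 0) F)"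
proof -
  obtain p :: "nat \<Rightarrow> 'x \<Rightarrow> real" where
    p: "\<And>k. seminorm (p k)" and
    op: "\<And>S. open S \<longleftrightarrow> (\<forall>x\<in>S. \<exists>m. \<exists>e>0. \<forall>y. (\<forall>k\<le>m. p k (y - x) < e) \<longrightarrow> y \<in> S)"
    using frechet by blast
  have nonneg: "p k z \<ge> 0" for k z
    by (rule seminorm_nonneg[OF p])
  have tri: "p k (x + y) \<le> p k x + p k y" and scale: "p k (c *\<^sub>C x) = cmod c * p k x"
    for k x y c using p[of k] unfolding seminorm_def by blast+
  have p0: "p k 0 = 0" for k using scale[of k 0 0] by simp
  have ball_open: "open {z. p k (z - a) < e}" for k a e
    unfolding op
  proof
    fix z assume "z \<in> {z. p k (z - a) < e}"
    hence z: "p k (z - a) < e" by simp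
    have "p k (y - a) < e" if "p k (y - z) < e - p k (z - a)" for y
      using tri[of k "y - z" "z - a"] that by simp
    thus "\<exists>m. \<exists>d>0. \<forall>y. (\<forall>k\<le>m. p k (y - z) < d) \<longrightarrow> y \<in> {z. p k (z - a) < e}"
      using z by (intro exI[of _ k] exI[of _ "e - p k (z - a)"]) auto
  qed
  have "(f \<longlongrightarrow> l) F \<longleftrightarrow> (\<forall>k. ((\<lambda>t. p k (f t - l)) \<longlongrightarrow> 0) F)"
    for f :: "'b \<Rightarrow> 'x" and l F
  proof
    assume f: "(f \<longlongrightarrow> l) F"
    show "\<forall>k. ((\<lambda>t. p k (f t - l)) \<longlongrightarrow> 0) F"
    proof (intro allI tendstoI)
      fix k and e :: real assume "e > 0"
      hence "\<forall>\<^sub>F t in F. f t \<in> {z. p k (z - l) < e}"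
        by (intro topological_tendstoD[OF f ball_open]) (simp add: p0)
      thus "\<forall>\<^sub>F t in F. dist (p k (f t - l)) 0 < e"
        by eventually_elim (simp add: nonneg)
    qed
  next
    assume f: "\<forall>k. ((\<lambda>t. p k (f t - l)) \<longlongrightarrow> 0) F"
    show "(f \<longlongrightarrow> l) F"
    proof (rule topological_tendstoI)
      fix S assume "open S" "l \<in> S"
      then obtain m e where "e > 0" and S: "\<And>y. (\<forall>k\<le>m. p k (y - l) < e) \<Longrightarrow> y \<in> S"
        using op by blast
      hence "\<forall>\<^sub>F t in F. \<forall>k\<in>{..m}. p k (f t - l) < e"
        using f by (intro eventually_ball_finite) (auto intro: order_tendstoD)
      thus "\<forall>\<^sub>F t in F. f t \<in> S"
        by eventually_elim (auto intro: S)
    qed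
  qed
  thus ?thesis using that p by blast
qed

lemma frechet_tendsto_diff:
  fixes f g :: "'b \<Rightarrow> 'x :: frechet_space"
  assumes "(f \<longlongrightarrow> a) F" "(g \<longlongrightarrow> b) F"
  shows "((\<lambda>t. f t - g t) \<longlongrightarrow> a - b) F"
proof -
  obtain p :: "nat \<Rightarrow> 'x \<Rightarrow> real" where
    p: "\<And>k. seminorm (p k)" and
    lim: "\<And>(f :: 'b \<Rightarrow> 'x) l F. (f \<longlongrightarrow> l) F \<longleftrightarrow> (\<forall>k. ((\<lambda>t. p k (f t - l)) \<longlongrightarrow> 0) F)"
    using frechet_tendsto_seminorms by blast
  show ?thesis
    unfolding lim
  proof
    fix k
    have tri: "p k (x + y) \<le> p k x + p k y" and scale: "p k (c *\<^sub>C x) = cmod c * p k x"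
      for x y c using p[of k] unfolding seminorm_def by blast+
    have "p k (f t - g t - (a - b)) \<le> p k (f t - a) + p k (g t - b)" for t
      using tri[of "f t - a" "- 1 *\<^sub>C (g t - b)"] scale[of "- 1" "g t - b"]
      by (simp add: algebra_simps)
    hence le: "\<forall>\<^sub>F t in F. p k (f t - g t - (a - b)) \<le> p k (f t - a) + p k (g t - b)"
      by (intro always_eventually allI)
    have nonneg: "\<forall>\<^sub>F t in F. 0 \<le> p k (f t - g t - (a - b))"
      by (intro always_eventually allI seminorm_nonneg p)
    have "((\<lambda>t. p k (f t - a) + p k (g t - b)) \<longlongrightarrow> 0 + 0) F"
      using assms unfolding lim by (intro tendsto_add) simp_all
    hence "((\<lambda>t. p k (f t - a) + p k (g t - b)) \<longlongrightarrow> 0) F"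
      by simp
    thus "((\<lambda>t. p k (f t - g t - (a - b))) \<longlongrightarrow> 0) F"
      by (rule tendsto_sandwich[OF nonneg le tendsto_const])
  qed
qed

lemma frechet_tendsto_scaleC:
  fixes f :: "'b \<Rightarrow> 'x :: frechet_space"
  assumes "(f \<longlongrightarrow> a) F"
  shows "((\<lambda>t. c *\<^sub>C f t) \<longlongrightarrow> c *\<^sub>C a) F"
proof -
  obtain p :: "nat \<Rightarrow> 'x \<Rightarrow> real" where
    p: "\<And>k. seminorm (p k)" and
    lim: "\<And>(f :: 'b \<Rightarrow> 'x) l F. (f \<longlongrightarrow> l) F \<longleftrightarrow> (\<forall>k. ((\<lambda>t. p k (f t - l)) \<longlongrightarrow> 0) F)"
    using frechet_tendsto_seminorms by blast
  have "p k (c *\<^sub>C f t - c *\<^sub>C a) = cmod c * p k (f t - a)" for k t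
    using p[of k] unfolding seminorm_def scaleC.scale_right_diff_distrib[symmetric] by blast
  thus ?thesis
    using assms unfolding lim by (simp add: tendsto_mult_right_zero)
qed


section \<open>Signals\<close>

text \<open>Approach from the right is possible at every time, also at 0, so the limit in
  \<open>time_deriv\<close> is unique.\<close>

lemma at_within_Ici_neq_bot: "t \<ge> 0 \<Longrightarrow> at t within {0..} \<noteq> (bot :: real filter)"
  using islimpt_subset[of t "{t<..}" "{0..}"] trivial_limit_at_right_real[of t]
  by (simp add: trivial_limit_within subset_iff)

lemma diff_quotient_vec:
  "diff_quotient (\<lambda>t. \<chi> i. f i t) t s = (\<chi> i. diff_quotient (f i) t s)"
  by (simp add: diff_quotient_def vec_eq_iff scaleC_vec_def)

lemma time_deriv_tendsto:
  assumes "time_differentiable f" "t \<ge> 0"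
  shows "(diff_quotient f t \<longlongrightarrow> time_deriv f t) (at t within {0..})"
proof -
  obtain l where l: "(diff_quotient f t \<longlongrightarrow> l) (at t within {0..})"
    using assms unfolding time_differentiable_def by blast
  show ?thesis
    using l tendsto_Lim[OF at_within_Ici_neq_bot[OF assms(2)] l] assms(2)
    by (simp add: time_deriv_def)
qed

lemma time_deriv_eqI:
  "t \<ge> 0 \<Longrightarrow> (diff_quotient f t \<longlongrightarrow> l) (at t within {0..}) \<Longrightarrow> time_deriv f t = l"
  by (simp add: time_deriv_def tendsto_Lim at_within_Ici_neq_bot)

lemma time_deriv_vec_tendsto:
  fixes f :: "'n :: finite \<Rightarrow> real \<Rightarrow> 'x :: frechet_space"
  assumes "\<And>i. time_differentiable (f i)" "t \<ge> 0"
  shows "(diff_quotient (\<lambda>t. \<chi> i. f i t) t \<longlongrightarrow> (\<chi> i. time_deriv (f i) t)) (at t within {0..})"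
  unfolding diff_quotient_vec using time_deriv_tendsto[OF assms] by (intro vec_tendstoI) simp

lemma time_differentiable_vec:
  fixes f :: "'n :: finite \<Rightarrow> real \<Rightarrow> 'x :: frechet_space"
  assumes "\<And>i. time_differentiable (f i)"
  shows "time_differentiable (\<lambda>t. \<chi> i. f i t)"
  unfolding time_differentiable_def using time_deriv_vec_tendsto[of f, OF assms] by blast

lemma time_deriv_vec:
  fixes f :: "'n :: finite \<Rightarrow> real \<Rightarrow> 'x :: frechet_space"
  assumes "\<And>i. time_differentiable (f i)"
  shows "time_deriv (\<lambda>t. \<chi> i. f i t) = (\<lambda>t. \<chi> i. time_deriv (f i) t)"
proof
  fix t :: real
  show "time_deriv (\<lambda>t. \<chi> i. f i t) t = (\<chi> i. time_deriv (f i) t)"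
  proof (cases "t \<ge> 0")
    case True
    thus ?thesis by (intro time_deriv_eqI time_deriv_vec_tendsto assms)
  qed (simp add: time_deriv_def vec_eq_iff)
qed

lemma time_smooth_vec:
  fixes f :: "'n :: finite \<Rightarrow> real \<Rightarrow> 'x :: frechet_space"
  assumes "\<And>i. time_smooth (f i)"
  shows "time_smooth (\<lambda>t. \<chi> i. f i t)"
proof -
  have diff: "time_differentiable ((time_deriv ^^ k) (f i))" for k i
    using assms by (simp add: time_smooth_def)
  have "(time_deriv ^^ k) (\<lambda>t. \<chi> i. f i t) = (\<lambda>t. \<chi> i. (time_deriv ^^ k) (f i) t)" for k
    by (induction k) (simp_all add: time_deriv_vec[OF diff])
  thus ?thesis
    unfolding time_smooth_def by (simp add: time_differentiable_vec diff)
qed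

text \<open>\<open>power_rel\<close> constrains components only; this recovers smoothness of the
  whole vector signal from theirs.\<close>

lemma signals_vec:
  fixes y :: "real \<Rightarrow> 'x :: frechet_space ^ 'n"
  assumes "\<And>i. (\<lambda>t. y t $ i) \<in> signals T"
  shows "y \<in> signals T"
  using assms time_smooth_vec[of "\<lambda>i t. y t $ i"]
  by (auto simp: signals_def vec_eq_iff)

lemma smoothly_vanishing_zero: "smoothly_vanishing T (\<lambda>_. 0 :: 'x :: frechet_space)"
proof -
  have "diff_quotient (\<lambda>_. 0 :: 'x) t = (\<lambda>_. 0)" for t
    by (simp add: diff_quotient_def)
  hence "time_deriv (\<lambda>_. 0 :: 'x) = (\<lambda>_. 0)"
    using time_deriv_eqI[of _ "\<lambda>_. 0 :: 'x" 0] by (fastforce simp: time_deriv_def)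
  hence "(time_deriv ^^ k) (\<lambda>_. 0 :: 'x) = (\<lambda>_. 0)" for k
    by (induction k) simp_all
  thus ?thesis by (simp add: smoothly_vanishing_def vanishing_def)
qed

lemma smoothly_vanishing_imp_vanishing: "smoothly_vanishing T f \<Longrightarrow> vanishing T f"
  unfolding smoothly_vanishing_def by (metis funpow_0)


section \<open>Relations\<close>

lemma relation_signals:
  assumes "relation T P" "(u, y) \<in> P"
  shows "u \<in> signals T" "y \<in> signals T"
  using assms unfolding relation_def by blast+

lemma relation_zero: "relation T P \<Longrightarrow> (\<lambda>_. 0, \<lambda>_. 0) \<in> P"
  and relation_add: "relation T P \<Longrightarrow> (u, y) \<in> P \<Longrightarrow> (u', y') \<in> P \<Longrightarrow>
    (\<lambda>t. u t + u' t, \<lambda>t. y t + y' t) \<in> P"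
  and relation_scaleC: "relation T P \<Longrightarrow> (u, y) \<in> P \<Longrightarrow> (\<lambda>t. c *\<^sub>C u t, \<lambda>t. c *\<^sub>C y t) \<in> P"
  unfolding relation_def by blast+

lemma relation_sum:
  assumes "relation T P" "finite I" "\<And>i. i \<in> I \<Longrightarrow> (u i, y i) \<in> P"
  shows "(\<lambda>t. \<Sum>i\<in>I. a i *\<^sub>C u i t, \<lambda>t. \<Sum>i\<in>I. a i *\<^sub>C y i t) \<in> P"
  using assms(2,3)
  by (induction I) (simp_all add: relation_zero[OF assms(1)]
      relation_add[OF assms(1) relation_scaleC[OF assms(1)]])

lemma Close_scalar_iff:
  assumes "relation T P"
  shows "(u, y) \<in> Close T P (scalar_rel T c) \<longleftrightarrow>
    u \<in> signals T \<and> (\<lambda>t. u t + c *\<^sub>C y t, y) \<in> P"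
proof
  assume "(u, y) \<in> Close T P (scalar_rel T c)"
  then obtain z where z: "u \<in> signals T" "y \<in> signals T" "z \<in> signals T"
    "(\<lambda>t. u t + z t, y) \<in> P" "\<forall>t\<in>T. z t = c *\<^sub>C y t"
    by (auto simp: Close_def scalar_rel_def)
  \<comment> \<open>Off \<open>T\<close> both sides are 0, because signals are extended by
    0.\<close>
  have "z t = c *\<^sub>C y t" for t
    using z by (cases "t \<in> T") (auto simp: signals_def)
  thus "u \<in> signals T \<and> (\<lambda>t. u t + c *\<^sub>C y t, y) \<in> P"
    using z by simp
next
  assume *: "u \<in> signals T \<and> (\<lambda>t. u t + c *\<^sub>C y t, y) \<in> P"
  \<comment> \<open>The scaled signal is the output of a scaled pair of \<open>P\<close>, hence a
    signal.\<close>
  hence "y \<in> signals T" "(\<lambda>t. c *\<^sub>C y t) \<in> signals T"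
    using relation_signals[OF assms] relation_scaleC[OF assms] by blast+
  thus "(u, y) \<in> Close T P (scalar_rel T c)"
    using * by (auto simp: Close_def scalar_rel_def intro!: bexI[of _ "\<lambda>t. c *\<^sub>C y t"])
qed

lemma Close_power_matrix_zero_iff:
  fixes y :: "real \<Rightarrow> 'x :: frechet_space ^ 'n"
  assumes "relation T P"
  shows "(\<lambda>_. 0, y) \<in> Close T (power_rel P) (matrix_rel T L) \<longleftrightarrow>
    (\<forall>i. (\<lambda>t. \<Sum>j\<in>UNIV. L $ i $ j *\<^sub>C y t $ j, \<lambda>t. y t $ i) \<in> P)"
proof
  assume "(\<lambda>_. 0, y) \<in> Close T (power_rel P) (matrix_rel T L)"
  then obtain z where z: "y \<in> signals T" "z \<in> signals T"
    "\<forall>i. (\<lambda>t. z t $ i, \<lambda>t. y t $ i) \<in> P"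
    "\<forall>t\<in>T. z t = (\<chi> i. \<Sum>j\<in>UNIV. L $ i $ j *\<^sub>C y t $ j)"
    by (auto simp: Close_def power_rel_def matrix_rel_def)
  have "z t = (\<chi> i. \<Sum>j\<in>UNIV. L $ i $ j *\<^sub>C y t $ j)" for t
    using z by (cases "t \<in> T") (auto simp: signals_def vec_eq_iff)
  thus "\<forall>i. (\<lambda>t. \<Sum>j\<in>UNIV. L $ i $ j *\<^sub>C y t $ j, \<lambda>t. y t $ i) \<in> P"
    using z(3) by simp
next
  assume *: "\<forall>i. (\<lambda>t. \<Sum>j\<in>UNIV. L $ i $ j *\<^sub>C y t $ j, \<lambda>t. y t $ i) \<in> P"
  define z where "z = (\<lambda>t. \<chi> i. \<Sum>j\<in>UNIV. L $ i $ j *\<^sub>C y t $ j)"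
  have "y \<in> signals T" "z \<in> signals T" "(\<lambda>_. 0 :: 'x ^ 'n) \<in> signals T"
    using relation_signals[OF assms spec[OF *]] relation_signals[OF assms relation_zero[OF assms]]
    by (simp_all add: z_def signals_vec)
  thus "(\<lambda>_. 0, y) \<in> Close T (power_rel P) (matrix_rel T L)"
    using * by (auto simp: Close_def power_rel_def matrix_rel_def z_def intro!: bexI[of _ z])
qed


section \<open>Synchronization\<close>

text \<open>Differences with a reference component \<open>k\<close> are blind to the diagonal, so
  they measure the distance to it.\<close>

lemma eventually_diagonal_iff:
  fixes y :: "'b \<Rightarrow> 'x :: frechet_space ^ 'n"
  shows "(\<forall>V. 0 \<in> interior V \<longrightarrow>
        (\<forall>\<^sub>F t in F. y t \<in> {d + v | d v. d \<in> range vec \<and> v \<in> V})) \<longleftrightarrow>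
    (\<forall>i. ((\<lambda>t. y t $ i - y t $ k) \<longlongrightarrow> 0) F)" (is "?L \<longleftrightarrow> ?R")
proof
  assume L: ?L
  show ?R
  proof (intro allI topological_tendstoI)
    fix i and S :: "'x set" assume S: "open S" "0 \<in> S"
    \<comment> \<open>Adding a diagonal vector does not change membership in
      \<open>V\<close>.\<close>
    define V where "V = {v :: 'x ^ 'n. v $ i - v $ k \<in> S}"
    have "((\<lambda>v :: 'x ^ 'n. v $ i - v $ k) \<longlongrightarrow> 0 $ i - 0 $ k) (nhds 0)"
      by (intro frechet_tendsto_diff tendsto_vec_nth) (simp_all add: filterlim_ident)
    hence "\<forall>\<^sub>F v in nhds 0. v \<in> V"
      using topological_tendstoD[of "\<lambda>v :: 'x ^ 'n. v $ i - v $ k" 0 _ S] S by (simp add: V_def)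
    hence "0 \<in> interior V"
      by (auto simp: eventually_nhds interior_def)
    hence "\<forall>\<^sub>F t in F. y t \<in> {d + v | d v. d \<in> range vec \<and> v \<in> V}"
      using L by blast
    thus "\<forall>\<^sub>F t in F. y t $ i - y t $ k \<in> S"
      by eventually_elim (auto simp: V_def)
  qed
next
  assume R: ?R
  show ?L
  proof (intro allI impI)
    fix V :: "('x ^ 'n) set" assume "0 \<in> interior V"
    \<comment> \<open>The diagonal point repeating component \<open>k\<close> serves as the
      approximation of \<open>y t\<close>.\<close>
    have "((\<lambda>t. y t - vec (y t $ k)) \<longlongrightarrow> 0) F"
      using R by (intro vec_tendstoI) simp
    hence "\<forall>\<^sub>F t in F. y t - vec (y t $ k) \<in> interior V"
      using \<open>0 \<in> interior V\<close> by (intro topological_tendstoD) auto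
    thus "\<forall>\<^sub>F t in F. y t \<in> {d + v | d v. d \<in> range vec \<and> v \<in> V}"
    proof eventually_elim
      case (elim t)
      have "y t = vec (y t $ k) + (y t - vec (y t $ k))" by simp
      thus ?case using elim interior_subset by blast
    qed
  qed
qed


section \<open>The spectrum transverse to the diagonal\<close>

text \<open>
  The determinant of this matrix is the characteristic polynomial, at \<open>c\<close>, of the endomorphism that
  \<open>L\<close> induces on the quotient by the diagonal.
\<close>

definition bordered :: "'n \<Rightarrow> complex ^ 'n ^ 'n \<Rightarrow> complex \<Rightarrow> complex ^ 'n ^ 'n" where
  "bordered k L c = (\<chi> i j. if j = k then 1 else (mat c - L) $ i $ j)"

lemma poly_det: "poly (det A) x = det (\<chi> i j. poly (A $ i $ j) x)"
  for A :: "complex poly ^ 'n ^ 'n"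
  by (simp add: det_def poly_sum poly_prod)

lemma poly_charpoly: "poly (charpoly L) x = det (mat x - L)"
  unfolding charpoly_def poly_det by (rule arg_cong[of _ _ det]) (simp add: vec_eq_iff mat_def)

lemma det_zero_iff_kernel: "det A = 0 \<longleftrightarrow> (\<exists>v. v \<noteq> 0 \<and> A *v v = 0)"
  for A :: "complex ^ 'n ^ 'n"
  using invertible_det_nz[of A] invertible_left_inverse[of A] matrix_left_invertible_ker[of A]
  by blast

text \<open>The multiset of roots is meaningful only for a nonzero polynomial. The sum
  \<open>M\<close> of all entry moduli bounds \<open>L\<close> in the operator norm for the maximum
  norm, so \<open>M + 1\<close> is not an eigenvalue.\<close>

lemma charpoly_nonzero: "charpoly L \<noteq> 0"
proof
  assume zero: "charpoly L = 0"
  define M where "M = (\<Sum>i\<in>UNIV. \<Sum>j\<in>UNIV. cmod (L $ i $ j))"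
  have "M \<ge> 0" by (simp add: M_def sum_nonneg)
  have "det (mat (of_real (M + 1)) - L) = 0"
    using zero poly_charpoly[of L] by simp
  then obtain v where v: "v \<noteq> 0" "(mat (of_real (M + 1)) - L) *v v = 0"
    using det_zero_iff_kernel by blast
  \<comment> \<open>Row \<open>i\<close> of the eigenvalue equation, with \<open>i\<close> an index
    of largest modulus, gives the contradiction \<open>(M + 1) * m \<le> M * m\<close>.\<close>
  define m where "m = Max (range (\<lambda>i. cmod (v $ i)))"
  have le_m: "cmod (v $ i) \<le> m" for i
    unfolding m_def by (rule Max_ge) auto
  have "m \<in> range (\<lambda>i. cmod (v $ i))"
    unfolding m_def by (rule Max_in) auto
  then obtain i where i: "m = cmod (v $ i)" by blast
  have "m > 0"
    using v(1) le_m by (metis norm_le_zero_iff not_le order_trans vec_eq_iff zero_index)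
  have "0 = (\<Sum>j\<in>UNIV. (mat (of_real (M + 1)) - L) $ i $ j * v $ j)"
    using v(2) by (simp add: vec_eq_iff matrix_vector_mult_def)
  also have "\<dots> = (\<Sum>j\<in>UNIV. (if j = i then of_real (M + 1) * v $ i else 0) - L $ i $ j * v $ j)"
    by (rule sum.cong) (auto simp: mat_def left_diff_distrib)
  finally have "of_real (M + 1) * v $ i = (\<Sum>j\<in>UNIV. L $ i $ j * v $ j)"
    by (simp add: sum_subtractf)
  hence "(M + 1) * m = cmod (\<Sum>j\<in>UNIV. L $ i $ j * v $ j)"
    using \<open>M \<ge> 0\<close> by (metis i norm_mult norm_of_real abs_of_nonneg add_nonneg_nonneg zero_le_one)
  also have "\<dots> \<le> (\<Sum>j\<in>UNIV. cmod (L $ i $ j) * m)"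
    by (rule sum_norm_le) (simp add: norm_mult mult_left_mono le_m)
  also have "\<dots> = (\<Sum>j\<in>UNIV. cmod (L $ i $ j)) * m"
    by (simp add: sum_distrib_right)
  also have "\<dots> \<le> M * m"
    unfolding M_def using \<open>m > 0\<close>
    by (intro mult_right_mono member_le_sum[of i UNIV "\<lambda>i. \<Sum>j\<in>UNIV. cmod (L $ i $ j)"])
      (auto simp: sum_nonneg)
  finally show False using \<open>m > 0\<close> by (simp add: distrib_right)
qed

text \<open>Adding all columns to column \<open>k\<close> keeps the determinant and, by the
  eigenvector equation, turns that column into \<open>c - a\<close> times the all-ones vector. The
  proof transposes in order to work with rows.\<close>

lemma det_mat_minus_eq:
  assumes "has_eigenvector L (\<chi> i. 1) a"
  shows "det (mat c - L) = (c - a) * det (bordered k L c)"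
proof -
  define B where "B = transpose (mat c - L)"
  have "(\<Sum>j\<in>UNIV. L $ i $ j) = a" for i
    using assms by (simp add: has_eigenvector_def vec_eq_iff matrix_vector_mult_def)
  hence row: "(\<Sum>j\<in>UNIV. B $ j) = (c - a) *s 1"
    by (simp add: B_def vec_eq_iff transpose_def sum_subtractf mat_def)
  have "det (\<chi> i. if i = k then (\<Sum>j\<in>UNIV. B $ j) else B $ i)
      = (\<Sum>j\<in>UNIV. det (\<chi> i. if i = k then B $ j else B $ i))"
    by (rule det_linear_row_sum) simp
  \<comment> \<open>For \<open>j \<noteq> k\<close>, rows \<open>j\<close> and \<open>k\<close>
    coincide.\<close>
  also have "\<dots> = (\<Sum>j\<in>UNIV. if j = k then det B else 0)"
  proof (rule sum.cong[OF refl])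
    fix j
    show "det (\<chi> i. if i = k then B $ j else B $ i) = (if j = k then det B else 0)"
    proof (cases "j = k")
      case True
      hence "(\<chi> i. if i = k then B $ j else B $ i) = B" by (simp add: vec_eq_iff)
      thus ?thesis using True by simp
    next
      case False
      thus ?thesis by (simp add: det_identical_rows[of j k] row_def vec_eq_iff)
    qed
  qed
  finally have "det B = det (\<chi> i. if i = k then (c - a) *s 1 else B $ i)"
    unfolding row by simp
  also have "\<dots> = (c - a) * det (\<chi> i. if i = k then 1 else B $ i)"
    by (rule det_row_mul)
  also have "(\<chi> i. if i = k then 1 else B $ i) = transpose (bordered k L c)"
    by (simp add: vec_eq_iff bordered_def B_def transpose_def)
  finally show ?thesis by (simp add: B_def)
qed

text \<open>The bordered determinant, read as a polynomial \<open>q\<close> in \<open>c\<close>, is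
  the cofactor of the linear factor at \<open>a\<close> in \<open>charpoly L\<close>. Removing one
  copy of \<open>a\<close> leaves exactly the roots of \<open>q\<close>, which may again include
  \<open>a\<close>.\<close>

lemma mem_spec_mset_minus_iff:
  assumes "has_eigenvector L (\<chi> i. 1) a"
  shows "c \<in># spec_mset L - {#a#} \<longleftrightarrow> det (bordered k L c) = 0"
proof -
  define q where "q = det (\<chi> i j. if j = k then 1 else (mat [:0, 1:] - (\<chi> i j. [:L $ i $ j:])) $ i $ j)"
  have q: "poly q x = det (bordered k L x)" for x
    unfolding q_def poly_det bordered_def
    by (rule arg_cong[of _ _ det]) (simp add: vec_eq_iff mat_def)
  have "charpoly L = [:- a, 1:] * q"
    by (rule poly_ext) (simp add: poly_charpoly det_mat_minus_eq[OF assms, of _ k] q algebra_simps)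
  moreover from this have "q \<noteq> 0" using charpoly_nonzero[of L] by auto
  ultimately have "spec_mset L = {#a#} + proots q"
    unfolding spec_mset_def by (simp add: proots_mult del: mult_pCons_left)
  thus ?thesis using \<open>q \<noteq> 0\<close> by (simp add: q)
qed

text \<open>Column \<open>k\<close> of the bordered matrix is all ones, so entry \<open>k\<close> of
  a kernel vector is the coefficient \<open>a\<close> of the diagonal direction. The other entries
  form a representative \<open>w\<close> normalized by \<open>w $ k = 0\<close>.\<close>

lemma bordered_kernel:
  assumes "det (bordered k L c) = 0"
  obtains w a where "w \<noteq> 0" "w $ k = 0" "\<And>i. (L *v w) $ i = c * w $ i + a"
proof -
  obtain v where v: "v \<noteq> 0" "bordered k L c *v v = 0"
    using assms det_zero_iff_kernel by blast
  define w where "w = (\<chi> j. if j = k then 0 else v $ j)"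
  have eq: "(L *v w) $ i = c * w $ i + v $ k" for i
  proof -
    have "0 = (\<Sum>j\<in>UNIV. bordered k L c $ i $ j * v $ j)"
      using v(2) by (simp add: vec_eq_iff matrix_vector_mult_def)
    also have "\<dots> = (\<Sum>j\<in>UNIV. (if j = k then v $ k else 0) + (if j = i then c * w $ i else 0)
        - L $ i $ j * w $ j)"
      by (rule sum.cong) (auto simp: bordered_def mat_def w_def algebra_simps)
    also have "\<dots> = v $ k + c * w $ i - (L *v w) $ i"
      by (simp add: sum.distrib sum_subtractf matrix_vector_mult_def)
    finally show ?thesis by (simp add: algebra_simps)
  qed
  \<comment> \<open>If \<open>w\<close> were 0, the equation would force entry \<open>k\<close> of
    \<open>v\<close> to vanish too.\<close>
  have "w \<noteq> 0"
  proof
    assume "w = 0"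
    hence "v $ k = 0" using eq[of k] by simp
    hence "v = w" by (simp add: w_def vec_eq_iff)
    thus False using v(1) \<open>w = 0\<close> by simp
  qed
  thus ?thesis using eq by (intro that[of w "v $ k"]) (simp_all add: w_def)
qed

text \<open>As a row vector, \<open>v\<close> annihilates the columns of \<open>mat c - L\<close> by
  the eigenvalue equation, and the column of ones because its entries sum to 0.\<close>

lemma bordered_left_kernel:
  assumes "v \<noteq> 0" "transpose L *v v = c *s v" "(\<Sum>i\<in>UNIV. v $ i) = 0"
  shows "det (bordered k L c) = 0"
proof -
  have "(\<Sum>i\<in>UNIV. bordered k L c $ i $ j * v $ i) = 0" for j
  proof (cases "j = k")
    case False
    have "(\<Sum>i\<in>UNIV. bordered k L c $ i $ j * v $ i)
        = (\<Sum>i\<in>UNIV. (if i = j then c * v $ j else 0) - L $ i $ j * v $ i)"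
      using False by (intro sum.cong) (auto simp: bordered_def mat_def algebra_simps)
    also have "\<dots> = (c *s v) $ j - (transpose L *v v) $ j"
      by (simp add: sum_subtractf matrix_vector_mult_def transpose_def)
    finally show ?thesis using assms(2) by simp
  qed (simp add: bordered_def assms(3))
  hence "transpose (bordered k L c) *v v = 0"
    by (simp add: vec_eq_iff matrix_vector_mult_def transpose_def)
  thus ?thesis
    using assms(1) det_zero_iff_kernel[of "transpose (bordered k L c)"] by auto
qed


section \<open>Polynomials in a matrix\<close>

text \<open>This is p(A) v, computed by Horner's scheme on vectors so that no matrix powers
  occur.\<close>

definition poly_mv :: "'a :: field ^ 'n ^ 'n \<Rightarrow> 'a poly \<Rightarrow> 'a ^ 'n \<Rightarrow> 'a ^ 'n" where
  "poly_mv A p v = fold_coeffs (\<lambda>a w. a *s v + A *v w) p 0"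

lemma poly_mv_0 [simp]: "poly_mv A 0 v = 0"
  by (simp add: poly_mv_def)

lemma poly_mv_pCons [simp]: "poly_mv A (pCons a p) v = a *s v + A *v poly_mv A p v"
  by (cases "a = 0 \<and> p = 0") (auto simp: poly_mv_def)

lemma poly_mv_add: "poly_mv A (p + q) v = poly_mv A p v + poly_mv A q v"
  by (induction p q rule: poly_induct2) (simp_all add: algebra_simps vec.add)

lemma poly_mv_smult: "poly_mv A (smult c p) v = c *s poly_mv A p v"
  by (induction p) (simp_all add: vec.scale_right_distrib vector_scalar_commute)

lemma poly_mv_monom: "poly_mv A (monom c k) v = c *s ((*v) A ^^ k) v"
  by (induction k) (simp_all add: monom_0 monom_Suc vector_scalar_commute)

lemma poly_mv_sum: "poly_mv A (\<Sum>i\<in>I. p i) v = (\<Sum>i\<in>I. poly_mv A (p i) v)"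
  by (induction I rule: infinite_finite_induct) (simp_all add: poly_mv_add)

text \<open>p(A) commutes with A - c. With \<open>poly_mv_linear_factor\<close>, this lets a linear
  factor of an annihilating polynomial be moved onto the vector.\<close>

lemma poly_mv_shift: "poly_mv A p (A *v v - c *s v) = A *v poly_mv A p v - c *s poly_mv A p v"
proof (induction p)
  case (pCons a p)
  show ?case
    by (simp add: pCons.IH vec.diff vec.add vector_scalar_commute mult.commute
        vec.scale_right_diff_distrib vec.scale_right_distrib)
qed simp

lemma poly_mv_linear_factor:
  "poly_mv A ([:- c, 1:] * p) v = A *v poly_mv A p v - c *s poly_mv A p v"
proof -
  have "[:- c, 1:] * p = pCons 0 p + smult (- c) p" by simp
  hence "poly_mv A ([:- c, 1:] * p) v = A *v poly_mv A p v + (- c) *s poly_mv A p v"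
    by (simp only: poly_mv_add poly_mv_smult poly_mv_pCons vec.scale_zero_left add_0)
  thus ?thesis by simp
qed

text \<open>The n + 1 Krylov vectors v, A v, ..., A^n v lie in dimension n, and a linear relation
  among them is the polynomial. Dependence of a set ignores repetitions, so coinciding vectors form
  a separate case.\<close>

lemma poly_mv_annihilator:
  fixes A :: "'a :: field ^ 'n ^ 'n"
  obtains p where "p \<noteq> 0" "poly_mv A p v = 0"
proof -
  define x where "x = (\<lambda>k. ((*v) A ^^ k) v)"
  show ?thesis
  proof (cases "inj_on x {..CARD('n)}")
    case True
    have "vec.dependent (x ` {..CARD('n)})"
    proof (rule vec.dependent_biggerset_general)
      have "vec.dim (x ` {..CARD('n)}) \<le> CARD('n)"
        by (rule dim_subset_UNIV_cart_gen)
      thus "card (x ` {..CARD('n)}) > vec.dim (x ` {..CARD('n)})"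
        by (simp add: card_image[OF True])
    qed
    then obtain u where u: "\<exists>w\<in>x ` {..CARD('n)}. u w \<noteq> 0" "(\<Sum>w\<in>x ` {..CARD('n)}. u w *s w) = 0"
      by (auto simp: vec.dependent_finite)
    define p where "p = (\<Sum>k\<le>CARD('n). monom (u (x k)) k)"
    have "coeff p k = u (x k)" if "k \<le> CARD('n)" for k
      using that by (simp add: p_def coeff_sum)
    hence "p \<noteq> 0" using u(1) by auto
    moreover have "poly_mv A p v = 0"
      using u(2) True by (simp add: p_def poly_mv_sum poly_mv_monom sum.reindex x_def)
    ultimately show ?thesis by (rule that)
  next
    case False
    then obtain i j where ij: "i \<noteq> j" "x i = x j" by (auto simp: inj_on_def)
    define p :: "'a poly" where "p = monom 1 i + monom (- 1) j"
    have "coeff p i = 1" using ij by (simp add: p_def)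
    hence "p \<noteq> 0" by auto
    moreover have "poly_mv A p v = 0"
      using ij by (simp add: p_def poly_mv_add poly_mv_monom x_def)
    ultimately show ?thesis by (rule that)
  qed
qed


section \<open>Stability of the transverse modes\<close>

lemma input_resilient_stableD:
  assumes "input_resilient T P" "stable_rel T P" "(u, y) \<in> P" "smoothly_vanishing T u"
  shows "smoothly_vanishing T y"
  using assms unfolding input_resilient_def smoothly_VIVO_def by blast

lemma transverse_smoothly_vanishing:
  fixes P :: "('x :: frechet_space, 'x) rel" and L :: "complex ^ 'n ^ 'n"
    and y :: "real \<Rightarrow> 'x ^ 'n"
  assumes P: "relation T P"
    and res: "\<And>c. input_resilient T (Close T P (scalar_rel T c))"
    and eig: "has_eigenvector L (\<chi> i. 1) a"
    and stable: "\<And>c. det (bordered k L c) = 0 \<Longrightarrow> stable_rel T (Close T P (scalar_rel T c))"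
    and y: "\<And>i. (\<lambda>t. \<Sum>j\<in>UNIV. L $ i $ j *\<^sub>C y t $ j, \<lambda>t. y t $ i) \<in> P"
    and v: "(\<Sum>i\<in>UNIV. v $ i) = 0"
  shows "smoothly_vanishing T (\<lambda>t. \<Sum>i\<in>UNIV. v $ i *\<^sub>C y t $ i)"
proof -
  define A where "A = transpose L"
  define S where "S = (\<lambda>v t. \<Sum>i\<in>UNIV. v $ i *\<^sub>C y t $ i)"
  have rows: "(\<Sum>j\<in>UNIV. L $ i $ j) = a" for i
    using eig by (simp add: has_eigenvector_def vec_eq_iff matrix_vector_mult_def)
  \<comment> \<open>All rows of \<open>L\<close> sum to \<open>a\<close>; hence \<open>A\<close>
    preserves the space of coefficient vectors with sum 0.\<close>
  have sum_A: "(\<Sum>i\<in>UNIV. (A *v v) $ i) = a * (\<Sum>i\<in>UNIV. v $ i)" for v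
  proof -
    have "(\<Sum>i\<in>UNIV. (A *v v) $ i) = (\<Sum>i\<in>UNIV. \<Sum>j\<in>UNIV. L $ j $ i * v $ j)"
      by (simp add: A_def matrix_vector_mult_def transpose_def)
    also have "\<dots> = (\<Sum>j\<in>UNIV. (\<Sum>i\<in>UNIV. L $ j $ i) * v $ j)"
      unfolding sum_distrib_right by (rule sum.swap)
    finally show ?thesis by (simp add: rows sum_distrib_left)
  qed
  \<comment> \<open>Combining the network equations with coefficients \<open>v\<close> moves
    \<open>L\<close> from the signal to its transpose on the coefficients.\<close>
  have S_rel: "(S (A *v v), S v) \<in> P" for v
  proof -
    have "(\<Sum>i\<in>UNIV. v $ i *\<^sub>C (\<Sum>j\<in>UNIV. L $ i $ j *\<^sub>C y t $ j)) = S (A *v v) t" for t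
    proof -
      have "(\<Sum>i\<in>UNIV. v $ i *\<^sub>C (\<Sum>j\<in>UNIV. L $ i $ j *\<^sub>C y t $ j))
          = (\<Sum>i\<in>UNIV. \<Sum>j\<in>UNIV. (L $ i $ j * v $ i) *\<^sub>C y t $ j)"
        by (simp add: scaleC.scale_sum_right mult.commute)
      also have "\<dots> = S (A *v v) t"
        unfolding S_def A_def matrix_vector_mult_def
        by (subst sum.swap) (simp add: scaleC.scale_sum_left transpose_def)
      finally show ?thesis .
    qed
    thus ?thesis
      using relation_sum[OF P finite, of UNIV "\<lambda>i t. \<Sum>j\<in>UNIV. L $ i $ j *\<^sub>C y t $ j"
          "\<lambda>i t. y t $ i" "\<lambda>i. v $ i"] y
      by (simp add: S_def)
  qed
  have S_diff: "S (A *v v - c *s v) t + c *\<^sub>C S v t = S (A *v v) t" for v c t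
    by (simp add: S_def scaleC.scale_sum_right scaleC.scale_left_diff_distrib sum_subtractf)
  have "smoothly_vanishing T (S v)"
    if "p \<noteq> 0" "poly_mv A p v = 0" "(\<Sum>i\<in>UNIV. v $ i) = 0" for p v
    using that
  proof (induction "degree p" arbitrary: p v)
    case 0
    then obtain b where "p = [:b:]" by (metis degree_eq_zeroE)
    \<comment> \<open>A nonzero constant polynomial kills only the zero vector.\<close>
    hence "v = 0" using "0.prems"(1,2) by (simp add: vec_eq_iff)
    thus ?case by (simp add: S_def smoothly_vanishing_zero)
  next
    case (Suc m)
    have "\<not> constant (poly p)"
      unfolding constant_degree Suc.hyps(2)[symmetric] by simp
    then obtain c where "poly p c = 0"
      using fundamental_theorem_of_algebra by blast
    then obtain q where pq: "p = [:- c, 1:] * q"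
      unfolding poly_eq_0_iff_dvd by (elim dvdE)
    have "q \<noteq> 0"
      using Suc.prems(1) pq by auto
    moreover have "degree p = Suc (degree q)"
      unfolding pq using \<open>q \<noteq> 0\<close> by (subst degree_mult_eq) auto
    ultimately have q: "m = degree q" "q \<noteq> 0"
      using Suc.hyps(2) by simp_all
    define w where "w = A *v v - c *s v"
    have sum_w: "(\<Sum>i\<in>UNIV. w $ i) = 0"
      using Suc.prems(3) by (simp add: w_def sum_subtractf sum_A flip: sum_distrib_left)
    have qw: "poly_mv A q w = 0"
      using Suc.prems(2) unfolding pq w_def by (simp only: poly_mv_linear_factor poly_mv_shift)
    show ?case
    proof (cases "det (bordered k L c) = 0")
      case True
      \<comment> \<open>The feedback \<open>c\<close> applied to \<open>S v\<close> completes the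
        input \<open>S w\<close> to \<open>S (A *v v)\<close>. Since \<open>q\<close> kills
        \<open>w\<close>, the induction hypothesis makes this input smoothly vanishing.\<close>
      have "(S w, S v) \<in> Close T P (scalar_rel T c)"
        unfolding Close_scalar_iff[OF P] S_diff w_def
        using S_rel relation_signals[OF P S_rel] by simp
      thus ?thesis
        by (rule input_resilient_stableD[OF res stable[OF True] _ Suc.hyps(1)[OF q qw sum_w]])
    next
      case False
      \<comment> \<open>A nonzero \<open>z\<close> would be a left eigenvector for \<open>c\<close>
        with entry sum 0, contradicting the nonzero determinant. So \<open>q\<close> already kills
        \<open>v\<close>.\<close>
      define z where "z = poly_mv A q v"
      have sum_poly: "(\<Sum>i\<in>UNIV. poly_mv A q v $ i) = 0" for q
        using Suc.prems(3)
        by (induction q) (simp_all add: sum.distrib sum_A flip: sum_distrib_left)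
      have "A *v z = c *s z"
        using Suc.prems(2) unfolding pq poly_mv_linear_factor z_def by simp
      hence "z = 0"
        using False bordered_left_kernel[of z L c k] sum_poly by (auto simp: A_def z_def)
      thus ?thesis
        using Suc.hyps(1)[OF q _ Suc.prems(3)] by (simp add: z_def)
    qed
  qed
  moreover obtain p where "p \<noteq> 0" "poly_mv A p v = 0"
    by (rule poly_mv_annihilator)
  ultimately show ?thesis
    using v by (simp add: S_def)
qed

lemma transverse_stable:
  fixes P :: "('x :: frechet_space, 'x) rel" and L :: "complex ^ 'n ^ 'n"
  assumes P: "relation T P"
    and wd: "well_defined T (Close T P (scalar_rel T b))"
    and eig: "has_eigenvector L (\<chi> i. 1) b"
    and sync: "\<And>y :: real \<Rightarrow> 'x ^ 'n.
      (\<And>i. (\<lambda>t. \<Sum>j\<in>UNIV. L $ i $ j *\<^sub>C y t $ j, \<lambda>t. y t $ i) \<in> P) \<Longrightarrow>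
      (\<And>i. ((\<lambda>t. y t $ i - y t $ k) \<longlongrightarrow> 0) (time_to_infinity T))"
    and c: "det (bordered k L c) = 0"
  shows "stable_rel T (Close T P (scalar_rel T c))"
  unfolding stable_rel_def
proof (intro allI impI)
  fix z assume "(\<lambda>_. 0, z) \<in> Close T P (scalar_rel T c)"
  hence z: "(\<lambda>t. c *\<^sub>C z t, z) \<in> P"
    by (simp add: Close_scalar_iff[OF P])
  obtain w a where w: "w \<noteq> 0" "w $ k = 0" "\<And>i. (L *v w) $ i = c * w $ i + a"
    using bordered_kernel[OF c] by blast
  have rows: "(\<Sum>j\<in>UNIV. L $ i $ j) = b" for i
    using eig by (simp add: has_eigenvector_def vec_eq_iff matrix_vector_mult_def)
  have "(\<lambda>t. a *\<^sub>C z t) \<in> signals T"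
    using relation_signals[OF P relation_scaleC[OF P z]] by blast
  then obtain y0 where "(\<lambda>t. a *\<^sub>C z t, y0) \<in> Close T P (scalar_rel T b)"
    using wd unfolding well_defined_def by blast
  hence y0: "(\<lambda>t. a *\<^sub>C z t + b *\<^sub>C y0 t, y0) \<in> P"
    by (simp add: Close_scalar_iff[OF P])
  \<comment> \<open>The matrix sends \<open>w\<close> times \<open>z\<close> to \<open>c\<close>
    times itself plus a diagonal excess \<open>a\<close> times \<open>z\<close>; \<open>y0\<close>
    was chosen with exactly this excess as its input.\<close>
  define y where "y = (\<lambda>t. \<chi> i. w $ i *\<^sub>C z t + y0 t)"
  have "(\<Sum>j\<in>UNIV. L $ i $ j *\<^sub>C y t $ j)
      = w $ i *\<^sub>C c *\<^sub>C z t + (a *\<^sub>C z t + b *\<^sub>C y0 t)" for i t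
  proof -
    have "(\<Sum>j\<in>UNIV. L $ i $ j *\<^sub>C y t $ j)
        = (L *v w) $ i *\<^sub>C z t + (\<Sum>j\<in>UNIV. L $ i $ j) *\<^sub>C y0 t"
      by (simp add: y_def scaleC_add_right sum.distrib scaleC.scale_sum_left matrix_vector_mult_def)
    thus ?thesis by (simp add: w(3) rows scaleC_add_left mult.commute)
  qed
  hence "(\<lambda>t. \<Sum>j\<in>UNIV. L $ i $ j *\<^sub>C y t $ j, \<lambda>t. y t $ i) \<in> P" for i
    using relation_add[OF P relation_scaleC[OF P z, of "w $ i"] y0] by (simp add: y_def)
  \<comment> \<open>As \<open>w $ k = 0\<close>, component \<open>k\<close> of \<open>y\<close> is
    \<open>y0\<close>, which cancels in the differences.\<close>
  hence lim: "((\<lambda>t. w $ i *\<^sub>C z t) \<longlongrightarrow> 0) (time_to_infinity T)" for i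
    using sync[of y i] w(2) by (simp add: y_def)
  obtain i where "w $ i \<noteq> 0" using w(1) by (auto simp: vec_eq_iff)
  thus "vanishing T z"
    using frechet_tendsto_scaleC[OF lim[of i], of "inverse (w $ i)"] by (simp add: vanishing_def)
qed

theorem theorem3p7:
  fixes T :: "real set"
    and P :: "('x :: frechet_space, 'x) rel"
    and L :: "complex ^ 'n ^ 'n"
    and lam1 :: complex
  assumes "time_set T"
    and "relation T P"
    and "\<And>c. input_resilient T (Close T P (scalar_rel T c))"
    and "has_eigenvector L (\<chi> i. 1) lam1"
  shows "synchronizes T (Close T (power_rel P) (matrix_rel T L)) \<longleftrightarrow>
    (\<forall>c. c \<in># spec_mset L - {#lam1#} \<longrightarrow> stable_rel T (Close T P (scalar_rel T c)))"
proof -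
  \<comment> \<open>An arbitrary reference component, used both to test synchronization and to
    border the matrix.\<close>
  fix k :: 'n
  note P = assms(2)
  have sync: "synchronizes T (Close T (power_rel P) (matrix_rel T L)) \<longleftrightarrow>
    (\<forall>y. (\<forall>i. (\<lambda>t. \<Sum>j\<in>UNIV. L $ i $ j *\<^sub>C y t $ j, \<lambda>t. y t $ i) \<in> P) \<longrightarrow>
      (\<forall>i. ((\<lambda>t. y t $ i - y t $ k) \<longlongrightarrow> 0) (time_to_infinity T)))"
    unfolding synchronizes_def Close_power_matrix_zero_iff[OF P] eventually_diagonal_iff[of _ _ k]
    using relation_signals(2)[OF P] by (blast intro: signals_vec)
  show ?thesis
    unfolding sync mem_spec_mset_minus_iff[OF assms(4), of _ k]
  proof (intro iffI allI impI)
    fix c assume "\<forall>y. (\<forall>i. (\<lambda>t. \<Sum>j\<in>UNIV. L $ i $ j *\<^sub>C y t $ j, \<lambda>t. y t $ i) \<in> P) \<longrightarrow>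
      (\<forall>i. ((\<lambda>t. y t $ i - y t $ k) \<longlongrightarrow> 0) (time_to_infinity T))"
      and c: "det (bordered k L c) = 0"
    moreover have "well_defined T (Close T P (scalar_rel T lam1))"
      using assms(3) by (simp add: input_resilient_def)
    ultimately show "stable_rel T (Close T P (scalar_rel T c))"
      by (intro transverse_stable[OF P _ assms(4) _ c]) auto
  next
    fix y :: "real \<Rightarrow> 'x ^ 'n" and i
    assume stable: "\<forall>c. det (bordered k L c) = 0 \<longrightarrow> stable_rel T (Close T P (scalar_rel T c))"
      and y: "\<forall>i. (\<lambda>t. \<Sum>j\<in>UNIV. L $ i $ j *\<^sub>C y t $ j, \<lambda>t. y t $ i) \<in> P"
    \<comment> \<open>The difference of two unit vectors has entry sum 0 and extracts the difference
      of components \<open>i\<close> and \<open>k\<close>.\<close>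
    have "smoothly_vanishing T (\<lambda>t. \<Sum>j\<in>UNIV. (axis i 1 - axis k 1 :: complex ^ 'n) $ j *\<^sub>C y t $ j)"
      using stable y
      by (intro transverse_smoothly_vanishing[OF P assms(3,4)])
        (auto simp: sum_subtractf axis_def)
    also have "(\<lambda>t. \<Sum>j\<in>UNIV. (axis i 1 - axis k 1 :: complex ^ 'n) $ j *\<^sub>C y t $ j)
        = (\<lambda>t. y t $ i - y t $ k)"
      by (simp add: scaleC.scale_left_diff_distrib sum_subtractf axis_def if_distrib[of "\<lambda>a. a *\<^sub>C _"]
          cong: if_cong)
    finally show "((\<lambda>t. y t $ i - y t $ k) \<longlongrightarrow> 0) (time_to_infinity T)"
      using smoothly_vanishing_imp_vanishing by (auto simp: vanishing_def)
  qed
qed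

end
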